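(* Let $\mathbf{a}=(a_0,\ldots,a_{m-1})$ be a weak $m$-part composition of $n$ and let $t=(k,l)$ be a lattice point with $0\le k\le n$ and $0\le l\le m$. Suppose that the point $(k+1,l)$ is dominated by every cyclic shift $\mathbf{a}^{j}$, $0\le j<m$ (i.e. $k+1\ge f_{\mathbf{a}^j}(l)$ for all $j$). Then $$|\mathscr{A}_t(\mathbf{a})| = m\binom{k+l}{l},\qquad |\mathscr{B}_t(\mathbf{a})| = n\binom{k+l}{l-1},$$ and $$|\mathscr{G}_t(\mathbf{a})| = |\mathscr{A}_t(\mathbf{a})|-|\mathscr{B}_t(\mathbf{a})| = \frac{m(k+1)-nl}{k+1}\binom{k+l}{l}.$$
   Context: A lattice path is a path in $\mathbb{Z}\times\mathbb{Z}$ using unit steps $(0,1)$ (up) and $(1,0)$ (right). A weak $m$-part composition of $n$ is a tuple $\mathbf{a}=(a_0,\ldots,a_{m-1})$ of nonnegative integers with sum $n$; indices of $\mathbf{a}$ are read modulo $m$. Define $f_{\mathbf{a}}:[0,m]\to\mathbb{R}$ by $f_{\mathbf{a}}(y)=a_i(y-i)+\sum_{j=0}^{i-1}a_j$ for $y\in[i,i+1]$, $i=0,\ldots,m-1$; its graph $\{x=f_{\mathbf{a}}(y)\}$ is the boundary curve of $\mathbf{a}$. A lattice point $(x,y)$ with $0\le y\le m$ is dominated by $\mathbf{a}$ if $x\ge f_{\mathbf{a}}(y)$, and a lattice path is dominated by $\mathbf{a}$ if all its lattice points are. For an integer $j$ the $j$-th cyclic shift is $\mathbf{a}^{j}=(a_{-j},a_{-j+1},\ldots,a_{-j+m-1})$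 (indices mod $m$). A lattice path boundary pair (LPBP) is an ordered pair $(P,(\mathbf{a},j))$ where $P$ is a lattice path starting at the origin and $0\le j<m$; it is good if $P$ is dominated by $\mathbf{a}^j$ and bad otherwise. $\mathscr{A}_t(\mathbf{a})$ is the set of all LPBPs $(P,(\mathbf{a},j))$ with $P$ ending at $t$, and $\mathscr{B}_t(\mathbf{a})$, $\mathscr{G}_t(\mathbf{a})$ are its subsets of bad and good pairs respectively. *)

theory Defs
  imports Complex_Main
begin

type_synonym point = "int \<times> int"

text \<open>A path is recorded as the nonempty list of lattice points it visits.\<close>

definition unit_step :: "point \<Rightarrow> point \<Rightarrow> bool" where
  "unit_step p q \<longleftrightarrow> q = (fst p, snd p + 1) \<or> q = (fst p + 1, snd p)"

definition lattice_path :: "point list \<Rightarrow> bool" where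
  "lattice_path P \<longleftrightarrow> P \<noteq> [] \<and> successively unit_step P"

definition weak_composition :: "nat \<Rightarrow> nat \<Rightarrow> nat list \<Rightarrow> bool" where
  "weak_composition m n a \<longleftrightarrow> length a = m \<and> sum_list a = n"

definition part :: "nat list \<Rightarrow> int \<Rightarrow> nat" where
  "part a i = a ! nat (i mod int (length a))"

definition cyclic_shift :: "nat list \<Rightarrow> int \<Rightarrow> nat list" where
  "cyclic_shift a j = map (\<lambda>i. part a (int i - j)) [0..<length a]"

text \<open>
  The piecewise linear function \<open>f\<^sub>a\<close>; it is only meaningful on the interval
  from 0 to \<open>length a\<close>. The minimum makes the right endpoint
  \<open>y = length a\<close> belong to the last linear piece.
\<close>

definition boundary :: "nat list \<Rightarrow> real \<Rightarrow> real" where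
  "boundary a y =
    (let i = min (nat \<lfloor>y\<rfloor>) (length a - 1)
     in real (a ! i) * (y - real i) + (\<Sum>j<i. real (a ! j)))"

definition dominates_point :: "nat list \<Rightarrow> point \<Rightarrow> bool" where
  "dominates_point a p \<longleftrightarrow>
    0 \<le> snd p \<and> snd p \<le> int (length a) \<and> real_of_int (fst p) \<ge> boundary a (real_of_int (snd p))"

definition dominates_path :: "nat list \<Rightarrow> point list \<Rightarrow> bool" where
  "dominates_path a P \<longleftrightarrow> (\<forall>p\<in>set P. dominates_point a p)"

type_synonym path_boundary_pair = "point list \<times> (nat list \<times> int)"

definition is_LPBP :: "path_boundary_pair \<Rightarrow> bool" where
  "is_LPBP = (\<lambda>(P, (a, j)).
    lattice_path P \<and> hd P = (0, 0) \<and> 0 \<le> j \<and> j < int (length a))"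

definition good :: "path_boundary_pair \<Rightarrow> bool" where
  "good = (\<lambda>(P, (a, j)). dominates_path (cyclic_shift a j) P)"

definition all_pairs :: "point \<Rightarrow> nat list \<Rightarrow> path_boundary_pair set" where
  "all_pairs t a = {(P, (a, j)) | P j. is_LPBP (P, (a, j)) \<and> last P = t}"

definition bad_pairs :: "point \<Rightarrow> nat list \<Rightarrow> path_boundary_pair set" where
  "bad_pairs t a = {x \<in> all_pairs t a. \<not> good x}"

definition good_pairs :: "point \<Rightarrow> nat list \<Rightarrow> path_boundary_pair set" where
  "good_pairs t a = {x \<in> all_pairs t a. good x}"

end

theory Submission
  imports Defs "HOL-Library.Sublist"
begin

text \<open>
  Cut a bad path after its first non-dominated lattice point, \<open>P = Q U W\<close>; the last step of the
  first piece is necessarily an up step \<open>U\<close>. If \<open>Q\<close> ends at \<open>(x, y)\<close> and \<open>i\<close> is the index of the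
  part of the composition crossed by \<open>U\<close>, then \<open>x\<close> exceeds the sum \<open>s\<close> of the \<open>y\<close> parts preceding
  the \<open>i\<close>-th by some \<open>c < a\<^sub>i\<close>. Turn \<open>Q\<close> around and replace \<open>U\<close> by a right step \<open>R\<close>. In
  \<open>Q\<^sup>r R W\<close>, a path from the origin to \<open>(k + 1, l - 1)\<close>, the piece \<open>Q\<^sup>r\<close> ends just before the
  path first crosses to the right of the boundary with initial offset \<open>c\<close> and parts
  \<open>a\<^bsub>i-1\<^esub>, a\<^bsub>i-2\<^esub>, \<dots>\<close>. The hypothesis on \<open>(k + 1, l)\<close> says that every such path crosses every such
  boundary, so bad pairs correspond bijectively to triples \<open>(i, c, V)\<close> with \<open>c < a\<^sub>i\<close> and \<open>V\<close> a path
  to \<open>(k + 1, l - 1)\<close>.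
\<close>

section \<open>Lattice paths as words\<close>

text \<open>A path is encoded by its steps, \<open>True\<close> standing for up and \<open>False\<close> for right.\<close>

abbreviation ups :: "bool list \<Rightarrow> nat" where
  "ups w \<equiv> count_list w True"

abbreviation rights :: "bool list \<Rightarrow> nat" where
  "rights w \<equiv> count_list w False"

definition words :: "nat \<Rightarrow> nat \<Rightarrow> bool list set" where
  "words r u = {w. rights w = r \<and> ups w = u}"

lemma words_0_0: "words 0 0 = {[]}"
proof -
  have "w = []" if "rights w = 0" "ups w = 0" for w
    using that by (cases w) (auto split: if_splits)
  then show ?thesis by (auto simp: words_def)
qed

text \<open>Splitting off the first step. The guards exclude the zero cases, where truncated
  subtraction would admit words with one step too many.\<close>

lemma words_rec:
  assumes "r + u > 0"
  shows "words r u = (if u = 0 then {} else (#) True ` words r (u - 1)) \<union>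
    (if r = 0 then {} else (#) False ` words (r - 1) u)"
proof (intro set_eqI)
  fix w
  show "w \<in> words r u \<longleftrightarrow> w \<in> (if u = 0 then {} else (#) True ` words r (u - 1)) \<union>
    (if r = 0 then {} else (#) False ` words (r - 1) u)"
  proof (cases w)
    case Nil
    then show ?thesis using assms by (auto simp: words_def)
  next
    case (Cons b v)
    then show ?thesis by (cases b) (auto simp: words_def image_iff)
  qed
qed

lemma finite_card_words: "finite (words r u) \<and> card (words r u) = (r + u) choose u"
proof (induction "r + u" arbitrary: r u)
  case 0
  then show ?case by (simp add: words_0_0)
next
  case (Suc s)
  have up: "finite (words r (u - 1)) \<and> card (words r (u - 1)) = s choose (u - 1)" if "u > 0"
  proof -
    have "s = r + (u - 1)" using Suc.hyps(2) that by simp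
    then show ?thesis using Suc.hyps(1) by blast
  qed
  have right: "finite (words (r - 1) u) \<and> card (words (r - 1) u) = s choose u" if "r > 0"
  proof -
    have "s = r - 1 + u" using Suc.hyps(2) that by simp
    then show ?thesis using Suc.hyps(1) by blast
  qed
  have disj: "(#) True ` A \<inter> (#) False ` B = {}" for A B
    by auto
  have rec: "words r u = (if u = 0 then {} else (#) True ` words r (u - 1)) \<union>
    (if r = 0 then {} else (#) False ` words (r - 1) u)"
    using Suc.hyps(2) by (intro words_rec) auto
  consider "u = 0" "r > 0" | "r = 0" "u = Suc s" | "r > 0" "u > 0"
    using Suc.hyps(2) by fastforce
  then show ?case
  proof cases
    case 1
    then show ?thesis using rec right by (simp add: card_image)
  next
    case 2
    then show ?thesis using rec up by (simp add: card_image)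
  next
    case 3
    then have "card (words r u) = (s choose (u - 1)) + (s choose u)"
      using rec up right disj by (simp add: card_Un_disjoint card_image)
    moreover have "r + u choose u = (s choose (u - 1)) + (s choose u)"
      using 3 Suc.hyps(2) by (cases u) (simp_all flip: Suc.hyps(2))
    moreover have "finite (words r u)"
      using 3 rec up right by simp
    ultimately show ?thesis by simp
  qed
qed

fun vertices :: "point \<Rightarrow> bool list \<Rightarrow> point list" where
  "vertices p [] = [p]"
| "vertices p (b # w) =
    p # vertices (if b then (fst p, snd p + 1) else (fst p + 1, snd p)) w"

lemma vertices_nonempty [simp]: "vertices p w \<noteq> []"
  by (cases w) auto

lemma hd_vertices [simp]: "hd (vertices p w) = p"
  by (cases w) auto

lemma last_vertices: "last (vertices p w) = (fst p + int (rights w), snd p + int (ups w))"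
  by (induction p w rule: vertices.induct) auto

lemma successively_vertices: "successively unit_step (vertices p w)"
  by (induction p w rule: vertices.induct) (auto simp: successively_Cons unit_step_def)

lemma vertices_inject: "vertices p v = vertices p w \<Longrightarrow> v = w"
proof (induction v arbitrary: p w)
  case Nil
  then show ?case by (cases w) (auto simp: eq_commute[of "[]"])
next
  case (Cons b v)
  then obtain d w' where w: "w = d # w'"
    by (cases w) auto
  define step :: "bool \<Rightarrow> point"
    where "step x = (if x then (fst p, snd p + 1) else (fst p + 1, snd p))" for x
  have eq: "vertices (step b) v = vertices (step d) w'"
    using Cons.prems w by (simp add: step_def)
  then have "step b = step d"
    by (metis hd_vertices)
  then have "b = d"
    by (auto simp: step_def split: if_splits)
  then show ?case using Cons.IH eq w by blast
qed

lemma lattice_path_vertices: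
  assumes "successively unit_step P" "P \<noteq> []"
  shows "\<exists>w. P = vertices (hd P) w"
  using assms
proof (induction P)
  case (Cons p P)
  show ?case
  proof (cases "P = []")
    case True
    then have "p # P = vertices p []" by simp
    then show ?thesis by (metis list.sel(1))
  next
    case False
    then obtain w where w: "P = vertices (hd P) w"
      using Cons by (auto simp: successively_Cons)
    have "unit_step p (hd P)"
      using Cons.prems False by (auto simp: successively_Cons)
    then have "p # P = vertices p (True # w) \<or> p # P = vertices p (False # w)"
      using w by (auto simp: unit_step_def)
    then show ?thesis by (metis list.sel(1))
  qed
qed simp

text \<open>Visited points correspond to prefixes of the word, so domination of a path becomes a
  condition on all prefixes.\<close>

lemma set_vertices:
  "set (vertices p w) = {(fst p + int (rights u), snd p + int (ups u)) |u. prefix u w}"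
proof (induction p w rule: vertices.induct)
  case (2 p b w)
  show ?case
    unfolding vertices.simps list.set 2
    by (auto simp: prefix_Cons) (force intro: exI[of _ "[]"] exI[of _ "b # _"])+
qed auto

section \<open>The first point violating a condition on prefixes\<close>

text \<open>Used twice: to cut a bad path at its first non-dominated point, and to cut a turned path
  at its first crossing of the reversed boundary.\<close>

lemma shortest_failing_prefix:
  assumes "P []" "prefix u w" "\<not> P u"
  obtains Q b W where "w = Q @ b # W" "\<And>v. prefix v Q \<Longrightarrow> P v" "\<not> P (Q @ [b])"
proof -
  have "\<exists>Q b W. w = Q @ b # W \<and> (\<forall>v. prefix v Q \<longrightarrow> P v) \<and> \<not> P (Q @ [b])"
    using assms(2,3)
  proof (induction w arbitrary: u rule: rev_induct)
    case Nil
    then show ?case using assms(1) by simp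
  next
    case (snoc x xs)
    show ?case
    proof (cases "\<forall>v. prefix v xs \<longrightarrow> P v")
      case True
      then have "u = xs @ [x]"
        using snoc.prems by (auto simp: prefix_snoc)
      then show ?thesis using True snoc.prems by blast
    next
      case False
      then obtain Q b W where "xs = Q @ b # W" "\<forall>v. prefix v Q \<longrightarrow> P v" "\<not> P (Q @ [b])"
        using snoc.IH by blast
      then have "xs @ [x] = Q @ b # (W @ [x]) \<and> (\<forall>v. prefix v Q \<longrightarrow> P v) \<and> \<not> P (Q @ [b])"
        by simp
      then show ?thesis by blast
    qed
  qed
  then show thesis using that by blast
qed

text \<open>Both failing prefixes belong to the same word, hence are comparable; a strictly shorter
  one would be a prefix of the other's initial piece, where \<open>P\<close> holds.\<close>

lemma shortest_failing_prefix_unique: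
  assumes "Q @ b # W = Q' @ b' # W'"
    and "\<And>v. prefix v Q \<Longrightarrow> P v" "\<not> P (Q @ [b])"
    and "\<And>v. prefix v Q' \<Longrightarrow> P v" "\<not> P (Q' @ [b'])"
  shows "Q = Q' \<and> W = W'"
proof -
  have "prefix (Q @ [b]) (Q' @ b' # W')" "prefix (Q' @ [b']) (Q' @ b' # W')"
    using assms(1) by (metis append_Cons append_Nil append_assoc prefixI)+
  then have "prefix (Q @ [b]) (Q' @ [b']) \<or> prefix (Q' @ [b']) (Q @ [b])"
    using prefix_same_cases by blast
  then have "Q @ [b] = Q' @ [b']"
    using assms(2-5) by (auto simp: prefix_snoc)
  then show ?thesis using assms(1) by auto
qed

section \<open>Cyclic sums of parts\<close>

text \<open>For nonempty \<open>a\<close> and \<open>y\<close> at most \<open>length a\<close>, this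
  is the abscissa at height \<open>y\<close> of the boundary curve of the \<open>j\<close>-th
  shift.\<close>

definition part_sum_up :: "nat list \<Rightarrow> int \<Rightarrow> nat \<Rightarrow> nat" where
  "part_sum_up a j y = (\<Sum>q<y. part a (int q - j))"

text \<open>The boundary as met by a reversed path, which passes the parts in the opposite
  order.\<close>

definition part_sum_down :: "nat list \<Rightarrow> int \<Rightarrow> nat \<Rightarrow> nat" where
  "part_sum_down a i y = (\<Sum>q<y. part a (i - 1 - int q))"

lemma part_cong: "x mod int (length a) = y mod int (length a) \<Longrightarrow> part a x = part a y"
  by (simp add: part_def)

lemma part_sum_up_cong:
  assumes "i mod int (length a) = j mod int (length a)"
  shows "part_sum_up a i y = part_sum_up a j y"
  unfolding part_sum_up_def using assms by (intro sum.cong refl part_cong mod_diff_cong)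

lemma part_sum_down_cong:
  assumes "i mod int (length a) = j mod int (length a)"
  shows "part_sum_down a i y = part_sum_down a j y"
  unfolding part_sum_down_def using assms by (intro sum.cong refl part_cong mod_diff_cong)

text \<open>The last \<open>q\<close> of the first \<open>p + q\<close> parts of the shift, read
  backwards, start just below index \<open>p + q - j\<close>. This is how turning a path around
  exchanges the two kinds of sums.\<close>

lemma part_sum_up_split:
  "part_sum_up a j (p + q) = part_sum_up a j p + part_sum_down a (int (p + q) - j) q"
proof (induction q arbitrary: p)
  case (Suc q)
  have "part_sum_up a j (p + Suc q) =
      part_sum_up a j (Suc p) + part_sum_down a (int (Suc p + q) - j) q"
    using Suc[of "Suc p"] by simp
  then show ?case
    by (simp add: part_sum_up_def part_sum_down_def algebra_simps)
qed (simp add: part_sum_down_def)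

lemma part_sum_down_mono: "x \<le> y \<Longrightarrow> part_sum_down a i x \<le> part_sum_down a i y"
  unfolding part_sum_down_def by (intro sum_mono2) auto

text \<open>Both sides add the \<open>y + 1\<close> cyclically consecutive parts ending at index
  \<open>i\<close>; the first has index \<open>i - y\<close>, which gives the shift
  \<open>y - i\<close>.\<close>

lemma part_plus_part_sum_down:
  "part a i + part_sum_down a i y = part_sum_up a (int y - i) (Suc y)"
  using part_sum_up_split[of a "int y - i" 0 y] by (simp add: part_sum_up_def)

lemma sum_part: "(\<Sum>i\<in>{0..<int (length a)}. part a i) = sum_list a"
proof -
  have "(\<Sum>i\<in>{0..<int (length a)}. part a i) = (\<Sum>i<length a. part a (int i))"
    by (rule sum.reindex_bij_witness[of _ int nat]) auto
  also have "\<dots> = (\<Sum>i<length a. a ! i)"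
    by (intro sum.cong) (auto simp: part_def)
  finally show ?thesis by (simp add: sum_list_sum_nth atLeast0LessThan)
qed

lemma boundary_of_nat:
  assumes "y \<le> length a" "a \<noteq> []"
  shows "boundary a (real y) = (\<Sum>j<y. real (a ! j))"
proof (cases "y = length a")
  case True
  \<comment> \<open>At the right endpoint \<open>min\<close> selects the last piece, whose linear
    term at distance 1 supplies the last part; at smaller heights that term vanishes.\<close>
  then obtain z where "y = Suc z" using assms(2) by (metis length_0_conv not0_implies_Suc)
  then show ?thesis using True[symmetric] by (simp add: boundary_def)
next
  case False
  then have "min y (length a - 1) = y" using assms by simp
  then show ?thesis by (simp add: boundary_def)
qed

lemma dominates_point_cyclic_shift:
  assumes "a \<noteq> []" "y \<le> length a"
  shows "dominates_point (cyclic_shift a j) (int x, int y) \<longleftrightarrow> part_sum_up a j y \<le> x"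
proof -
  have "boundary (cyclic_shift a j) (real y) = (\<Sum>i<y. real (cyclic_shift a j ! i))"
    using assms by (intro boundary_of_nat) (auto simp: cyclic_shift_def)
  also have "\<dots> = real (part_sum_up a j y)"
    unfolding part_sum_up_def of_nat_sum using assms
    by (intro sum.cong) (auto simp: cyclic_shift_def)
  finally show ?thesis
    using assms by (simp add: dominates_point_def cyclic_shift_def)
qed

section \<open>Bad pairs\<close>

definition bad_words :: "nat \<Rightarrow> nat \<Rightarrow> nat list \<Rightarrow> (int \<times> bool list) set" where
  "bad_words k l a = {(j, w). 0 \<le> j \<and> j < int (length a) \<and> w \<in> words k l \<and>
    (\<exists>u. prefix u w \<and> rights u < part_sum_up a j (ups u))}"

definition cut_bad_words :: "nat \<Rightarrow> nat \<Rightarrow> nat list \<Rightarrow> (int \<times> bool list \<times> bool list) set" where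
  "cut_bad_words k l a = {(j, Q, W). 0 \<le> j \<and> j < int (length a) \<and> Q @ True # W \<in> words k l \<and>
    (\<forall>u. prefix u Q \<longrightarrow> part_sum_up a j (ups u) \<le> rights u) \<and>
    rights Q < part_sum_up a j (Suc (ups Q))}"

lemma ups_prefix_le: "prefix u w \<Longrightarrow> ups u \<le> ups w"
  by (auto simp: prefix_def)

lemma bij_betw_cut_bad_words:
  "bij_betw (\<lambda>(j, Q, W). (j, Q @ True # W)) (cut_bad_words k l a) (bad_words k l a)"
  unfolding bij_betw_def
proof
  show "inj_on (\<lambda>(j, Q, W). (j, Q @ True # W)) (cut_bad_words k l a)"
  proof -
    have "Q = Q' \<and> W = W'"
      if "(j, Q, W) \<in> cut_bad_words k l a" "(j, Q', W') \<in> cut_bad_words k l a"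
        and eq: "Q @ True # W = Q' @ True # W'" for j Q W Q' W'
      using eq
      by (rule shortest_failing_prefix_unique
          [where P = "\<lambda>u. part_sum_up a j (ups u) \<le> rights u"])
        (use that in \<open>auto simp: cut_bad_words_def\<close>)
    then show ?thesis by (fastforce intro!: inj_onI)
  qed
  show "(\<lambda>(j, Q, W). (j, Q @ True # W)) ` cut_bad_words k l a = bad_words k l a"
  proof (intro equalityI subsetI)
    fix z assume "z \<in> (\<lambda>(j, Q, W). (j, Q @ True # W)) ` cut_bad_words k l a"
    then obtain j Q W where z: "z = (j, Q @ True # W)" "(j, Q, W) \<in> cut_bad_words k l a"
      by auto
    have "prefix (Q @ [True]) (Q @ True # W)"
      by simp
    moreover have "rights (Q @ [True]) < part_sum_up a j (ups (Q @ [True]))"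
      using z(2) by (simp add: cut_bad_words_def)
    ultimately show "z \<in> bad_words k l a"
      using z unfolding bad_words_def cut_bad_words_def by blast
  next
    fix z assume z: "z \<in> bad_words k l a"
    then obtain j w u where zj: "z = (j, w)" and u: "prefix u w" "rights u < part_sum_up a j (ups u)"
      by (auto simp: bad_words_def)
    obtain Q b W where w: "w = Q @ b # W"
      and Q: "\<And>v. prefix v Q \<Longrightarrow> part_sum_up a j (ups v) \<le> rights v"
      and fail: "\<not> part_sum_up a j (ups (Q @ [b])) \<le> rights (Q @ [b])"
      using shortest_failing_prefix[of "\<lambda>u. part_sum_up a j (ups u) \<le> rights u" u w] u
      by (auto simp: part_sum_up_def)
    \<comment> \<open>A right step raises \<open>rights\<close> at unchanged height, so it cannot
      destroy the inequality.\<close>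
    have b
      using fail Q[of Q] by (cases b) auto
    then have "(j, Q, W) \<in> cut_bad_words k l a"
      using z zj w Q fail by (auto simp: bad_words_def cut_bad_words_def)
    then show "z \<in> (\<lambda>(j, Q, W). (j, Q @ True # W)) ` cut_bad_words k l a"
      using zj w \<open>b\<close> by force
  qed
qed

section \<open>Turning the first piece of a bad path around\<close>

lemma below_boundary_rev:
  assumes "(int (ups Q) - j) mod int (length a) = i mod int (length a)"
    and x: "rights Q = c + part_sum_up a j (ups Q)"
  shows "(\<forall>u. prefix u Q \<longrightarrow> part_sum_up a j (ups u) \<le> rights u) \<longleftrightarrow>
    (\<forall>v. prefix v (rev Q) \<longrightarrow> rights v \<le> c + part_sum_down a i (ups v))"
proof -
  \<comment> \<open>Splitting the endpoint condition \<open>x\<close> over both pieces shows that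
    the surplus of \<open>u\<close> over its boundary equals the deficit of \<open>v\<close> below
    the offset boundary.\<close>
  have eq: "part_sum_up a j (ups u) \<le> rights u \<longleftrightarrow>
      rights (rev v) \<le> c + part_sum_down a i (ups (rev v))" if "Q = u @ v" for u v
  proof -
    have "part_sum_up a j (ups Q) = part_sum_up a j (ups u) + part_sum_down a i (ups v)"
      using part_sum_up_split[of a j "ups u" "ups v"] part_sum_down_cong[OF assms(1)] that
      by simp
    then show ?thesis using x that by auto
  qed
  show ?thesis
  proof (intro iffI allI impI)
    fix v assume *: "\<forall>u. prefix u Q \<longrightarrow> part_sum_up a j (ups u) \<le> rights u" "prefix v (rev Q)"
    then obtain u where "rev Q = v @ u" by (auto simp: prefix_def)
    then have Q: "Q = rev u @ rev v" by (metis rev_append rev_rev_ident)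
    then have "prefix (rev u) Q" by simp
    then have "part_sum_up a j (ups (rev u)) \<le> rights (rev u)"
      using *(1) by blast
    then show "rights v \<le> c + part_sum_down a i (ups v)"
      using eq[OF Q] by simp
  next
    fix u assume *: "\<forall>v. prefix v (rev Q) \<longrightarrow> rights v \<le> c + part_sum_down a i (ups v)" "prefix u Q"
    then obtain v where Q: "Q = u @ v" by (auto simp: prefix_def)
    then have "prefix (rev v) (rev Q)" by simp
    then show "part_sum_up a j (ups u) \<le> rights u"
      using eq[OF Q] *(1) by blast
  qed
qed

lemma part_sum_up_eq_down:
  assumes "(int y - j) mod int (length a) = i mod int (length a)"
  shows "part_sum_up a j y = part_sum_down a i y"
  using part_sum_up_split[of a j 0 y] part_sum_down_cong[OF assms]
  by (simp add: part_sum_up_def)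

lemma part_sum_up_Suc_mod:
  "part_sum_up a j (Suc y) = part_sum_up a j y + part a ((int y - j) mod int (length a))"
  by (simp add: part_sum_up_def part_def)

text \<open>One equivalence serves both directions of the bijection. Here \<open>c\<close> is the
  distance from the boundary to the end of \<open>Q\<close>, and the up step violates domination
  exactly if \<open>c < part a i\<close>.\<close>

lemma cut_bad_words_iff:
  assumes "0 \<le> j" "j < int (length a)" and i: "i = (int (ups Q) - j) mod int (length a)"
  shows "(j, Q, W) \<in> cut_bad_words k (Suc l) a \<and> c = rights Q - part_sum_up a j (ups Q) \<longleftrightarrow>
    c < part a i \<and> rev Q @ False # W \<in> words (Suc k) l \<and>
    rights Q = c + part_sum_down a i (ups Q) \<and>
    (\<forall>v. prefix v (rev Q) \<longrightarrow> rights v \<le> c + part_sum_down a i (ups v))"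
    (is "?L \<longleftrightarrow> ?R")
proof -
  have im: "(int (ups Q) - j) mod int (length a) = i mod int (length a)"
    by (simp add: i)
  note rev_iff = below_boundary_rev[OF im, of c]
  have words: "Q @ True # W \<in> words k (Suc l) \<longleftrightarrow> rev Q @ False # W \<in> words (Suc k) l"
    by (auto simp: words_def)
  have up: "part_sum_up a j (Suc (ups Q)) = part_sum_up a j (ups Q) + part a i"
    by (simp add: part_sum_up_Suc_mod i)
  have down: "part_sum_up a j (ups Q) = part_sum_down a i (ups Q)"
    by (rule part_sum_up_eq_down[OF im])
  show ?thesis
  proof
    assume L: ?L
    \<comment> \<open>\<open>Q\<close> is a prefix of itself, so the subtraction defining
      \<open>c\<close> is not truncated.\<close>
    then have "part_sum_up a j (ups Q) \<le> rights Q"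
      by (auto simp: cut_bad_words_def)
    then have "rights Q = c + part_sum_up a j (ups Q)"
      using L by simp
    then show ?R
      using L rev_iff words up down by (auto simp: cut_bad_words_def)
  next
    assume ?R
    then show ?L
      using assms rev_iff words up down by (auto simp: cut_bad_words_def)
  qed
qed

text \<open>Injectivity rests on the uniqueness of the first crossing; \<open>window\<close> enters
  through surjectivity, where it forces every word to cross.\<close>

lemma bij_betw_turned_bad_words:
  assumes window: "\<And>j. 0 \<le> j \<Longrightarrow> j < int (length a) \<Longrightarrow> part_sum_up a j (Suc l) \<le> Suc k"
  shows "bij_betw
    (\<lambda>(j, Q, W). (((int (ups Q) - j) mod int (length a), rights Q - part_sum_up a j (ups Q)),
      rev Q @ False # W))
    (cut_bad_words k (Suc l) a)
    ((SIGMA i:{0..<int (length a)}. {..<part a i}) \<times> words (Suc k) l)"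
    (is "bij_betw ?f ?D ?E")
  unfolding bij_betw_def
proof
  show "inj_on ?f ?D"
  proof (rule inj_onI)
    fix z z' assume z: "z \<in> ?D" "z' \<in> ?D" and eq: "?f z = ?f z'"
    obtain j Q W where z1: "z = (j, Q, W)" by (cases z)
    obtain j' Q' W' where z2: "z' = (j', Q', W')" by (cases z')
    define i where "i = (int (ups Q) - j) mod int (length a)"
    define c where "c = rights Q - part_sum_up a j (ups Q)"
    have j: "0 \<le> j" "j < int (length a)" "0 \<le> j'" "j' < int (length a)"
      using z z1 z2 by (auto simp: cut_bad_words_def)
    have i': "i = (int (ups Q') - j') mod int (length a)"
      and c': "c = rights Q' - part_sum_up a j' (ups Q')"
      and V: "rev Q @ False # W = rev Q' @ False # W'"
      using eq z1 z2 by (auto simp: i_def c_def)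
    have 1: "rights Q = c + part_sum_down a i (ups Q) \<and>
        (\<forall>v. prefix v (rev Q) \<longrightarrow> rights v \<le> c + part_sum_down a i (ups v))"
      using cut_bad_words_iff[OF j(1,2) i_def, of W k l c] z z1 c_def by blast
    have 2: "rights Q' = c + part_sum_down a i (ups Q') \<and>
        (\<forall>v. prefix v (rev Q') \<longrightarrow> rights v \<le> c + part_sum_down a i (ups v))"
      using cut_bad_words_iff[OF j(3,4) i', of W' k l c] z z2 c' by blast
    have "rev Q = rev Q' \<and> W = W'"
      using V
      by (rule shortest_failing_prefix_unique
          [where P = "\<lambda>v. rights v \<le> c + part_sum_down a i (ups v)"])
        (use 1 2 in auto)
    then have QW: "Q = Q'" "W = W'" by auto
    have "(int (ups Q) - j) mod int (length a) = (int (ups Q) - j') mod int (length a)"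
      using i' QW i_def by simp
    \<comment> \<open>Subtracting from \<open>ups Q\<close> isolates the two shifts, which are
      reduced residues and hence equal.\<close>
    then have "(int (ups Q) - (int (ups Q) - j)) mod int (length a)
        = (int (ups Q) - (int (ups Q) - j')) mod int (length a)"
      by (rule mod_diff_cong[OF refl])
    then have "j mod int (length a) = j' mod int (length a)"
      by simp
    then have "j = j'"
      by (simp only: mod_pos_pos_trivial[OF j(1,2)] mod_pos_pos_trivial[OF j(3,4)])
    then show "z = z'" using QW z1 z2 by simp
  qed
  show "?f ` ?D = ?E"
  proof (intro equalityI subsetI)
    fix y assume "y \<in> ?f ` ?D"
    then obtain j Q W where D: "(j, Q, W) \<in> ?D" and y: "y = ?f (j, Q, W)"
      by auto
    then have j: "0 \<le> j" "j < int (length a)"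
      by (auto simp: cut_bad_words_def)
    define i where "i = (int (ups Q) - j) mod int (length a)"
    define c where "c = rights Q - part_sum_up a j (ups Q)"
    have "c < part a i \<and> rev Q @ False # W \<in> words (Suc k) l"
      using cut_bad_words_iff[OF j i_def, of W k l c] D c_def by blast
    moreover have "0 < int (length a)"
      using j by linarith
    then have "0 \<le> i" "i < int (length a)"
      by (simp_all add: i_def)
    ultimately show "y \<in> ?E"
      using y by (simp add: i_def c_def)
  next
    fix y assume "y \<in> ?E"
    then obtain i c V where y: "y = ((i, c), V)" and i: "0 \<le> i" "i < int (length a)"
      and c: "c < part a i" and V: "V \<in> words (Suc k) l"
      by auto
    have pos: "0 < int (length a)" using i by linarith
    \<comment> \<open>The window ending at index \<open>i\<close> controls the boundary at the final
      height \<open>l\<close>; \<open>c < part a i\<close> then puts the endpoint of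
      \<open>V\<close> strictly to its right.\<close>
    have "part a i + part_sum_down a i l = part_sum_up a ((int l - i) mod int (length a)) (Suc l)"
      unfolding part_plus_part_sum_down by (rule part_sum_up_cong) simp
    also have "\<dots> \<le> Suc k"
      using pos by (intro window) auto
    finally have "c + part_sum_down a i (ups V) < rights V"
      using c V by (simp add: words_def)
    then obtain R b W where R: "V = R @ b # W"
        "\<And>v. prefix v R \<Longrightarrow> rights v \<le> c + part_sum_down a i (ups v)"
        "\<not> rights (R @ [b]) \<le> c + part_sum_down a i (ups (R @ [b]))"
      using shortest_failing_prefix[of "\<lambda>v. rights v \<le> c + part_sum_down a i (ups v)" V V]
      by auto
    \<comment> \<open>An up step keeps \<open>rights\<close> and does not lower the bound, so the
      first crossing is a right step.\<close>
    have "\<not> b"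
      using R(2)[of R] R(3) part_sum_down_mono[of "ups R" "Suc (ups R)" a i] by (cases b) auto
    define Q where "Q = rev R"
    define j where "j = (int (ups Q) - i) mod int (length a)"
    have j: "0 \<le> j" "j < int (length a)"
      using pos by (auto simp: j_def)
    have "(int (ups Q) - j) mod int (length a) = i mod int (length a)"
      unfolding j_def by (simp add: mod_diff_right_eq)
    then have ij: "i = (int (ups Q) - j) mod int (length a)"
      using i by simp
    \<comment> \<open>Before the crossing \<open>rights\<close> is within the bound, and adding one
      exceeds it; hence equality.\<close>
    have "rights Q = c + part_sum_down a i (ups Q)"
      using R(2)[of R] R(3) \<open>\<not> b\<close> by (auto simp: Q_def)
    then have "(j, Q, W) \<in> ?D \<and> c = rights Q - part_sum_up a j (ups Q)"
      using cut_bad_words_iff[OF j ij, of W k l c] c V R \<open>\<not> b\<close> by (simp add: Q_def)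
    moreover from this have "y = ?f (j, Q, W)"
      using y ij R(1) \<open>\<not> b\<close> by (simp add: Q_def)
    ultimately show "y \<in> ?f ` ?D" by blast
  qed
qed

text \<open>There are \<open>sum_list a\<close> choices of \<open>(i, c)\<close>. The conditional is
  the binomial coefficient with lower index -1 read as 0, where truncated \<open>l - 1\<close> would
  give 1.\<close>

lemma card_bad_words:
  assumes "\<And>j. 0 \<le> j \<Longrightarrow> j < int (length a) \<Longrightarrow> part_sum_up a j l \<le> Suc k"
  shows "card (bad_words k l a) = sum_list a * (if l = 0 then 0 else (k + l) choose (l - 1))"
proof (cases l)
  case 0
  have "\<not> rights u < part_sum_up a j (ups u)" if "w \<in> words k l" "prefix u w" for j u w
    using that ups_prefix_le[of u w] 0 by (simp add: words_def part_sum_up_def)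
  then have "bad_words k l a = {}"
    unfolding bad_words_def by blast
  then show ?thesis using 0 by simp
next
  case (Suc l')
  have "card (bad_words k l a)
      = card ((SIGMA i:{0..<int (length a)}. {..<part a i}) \<times> words (Suc k) l')"
    using bij_betw_same_card[OF bij_betw_cut_bad_words[of k l a]]
      bij_betw_same_card[OF bij_betw_turned_bad_words[of a l' k]] assms Suc by simp
  also have "\<dots> = sum_list a * ((k + l) choose l')"
    using finite_card_words[of "Suc k" l'] Suc
    by (simp add: card_cartesian_product sum_part)
  finally show ?thesis using Suc by simp
qed

section \<open>From words back to path boundary pairs\<close>

definition pair_of_word :: "nat list \<Rightarrow> int \<times> bool list \<Rightarrow> path_boundary_pair" where
  "pair_of_word a = (\<lambda>(j, w). (vertices (0, 0) w, (a, j)))"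

lemma inj_pair_of_word: "inj (pair_of_word a)"
  by (rule injI) (auto simp: pair_of_word_def dest: vertices_inject)

lemma all_pairs_eq:
  "all_pairs (int k, int l) a = pair_of_word a ` ({0..<int (length a)} \<times> words k l)"
proof (intro equalityI subsetI)
  fix z assume "z \<in> all_pairs (int k, int l) a"
  then obtain P j where z: "z = (P, (a, j))" "0 \<le> j" "j < int (length a)"
    and P: "lattice_path P" "hd P = (0, 0)" "last P = (int k, int l)"
    by (auto simp: all_pairs_def is_LPBP_def)
  then obtain w where w: "P = vertices (0, 0) w"
    using lattice_path_vertices[of P] by (auto simp: lattice_path_def)
  then have "w \<in> words k l"
    using P(3) by (simp add: last_vertices words_def)
  then show "z \<in> pair_of_word a ` ({0..<int (length a)} \<times> words k l)"
    using z w by (force simp: pair_of_word_def)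
next
  fix z assume "z \<in> pair_of_word a ` ({0..<int (length a)} \<times> words k l)"
  then show "z \<in> all_pairs (int k, int l) a"
    by (auto simp: pair_of_word_def all_pairs_def is_LPBP_def lattice_path_def
        successively_vertices last_vertices words_def)
qed

text \<open>The bound on \<open>ups w\<close> keeps all vertices within the heights that
  \<open>dominates_point\<close> allows.\<close>

lemma good_pair_of_word:
  assumes "a \<noteq> []" "ups w \<le> length a"
  shows "good (pair_of_word a (j, w)) \<longleftrightarrow>
    (\<forall>u. prefix u w \<longrightarrow> part_sum_up a j (ups u) \<le> rights u)"
proof -
  have "dominates_point (cyclic_shift a j) (int (rights u), int (ups u))
      \<longleftrightarrow> part_sum_up a j (ups u) \<le> rights u" if "prefix u w" for u
    using that ups_prefix_le[of u w] assms by (intro dominates_point_cyclic_shift) auto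
  then show ?thesis
    by (auto simp: good_def pair_of_word_def dominates_path_def set_vertices)
qed

lemma bad_pairs_eq:
  assumes "l \<le> length a"
  shows "bad_pairs (int k, int l) a = pair_of_word a ` bad_words k l a"
proof -
  have "\<not> good (pair_of_word a (j, w)) \<longleftrightarrow> (j, w) \<in> bad_words k l a"
    if "0 \<le> j" "j < int (length a)" "w \<in> words k l" for j w
  proof -
    have "a \<noteq> []" using that by auto
    moreover have "ups w \<le> length a" using that assms by (simp add: words_def)
    ultimately show ?thesis
      using that good_pair_of_word[of a w j] by (auto simp: bad_words_def not_le)
  qed
  moreover have "bad_words k l a \<subseteq> {0..<int (length a)} \<times> words k l"
    by (auto simp: bad_words_def)
  ultimately show ?thesis
    unfolding bad_pairs_def all_pairs_eq by fastforce
qed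

theorem theorem1:
  fixes a :: "nat list" and m n k l :: nat
  assumes "weak_composition m n a"
    and "k \<le> n" and "l \<le> m"
    and "\<And>j::int. 0 \<le> j \<Longrightarrow> j < int m \<Longrightarrow>
           dominates_point (cyclic_shift a j) (int k + 1, int l)"
  shows "card (all_pairs (int k, int l) a) = m * ((k + l) choose l)
    \<and> card (bad_pairs (int k, int l) a)
        = n * (if l = 0 then 0 else (k + l) choose (l - 1))
    \<and> real (card (good_pairs (int k, int l) a))
        = real (card (all_pairs (int k, int l) a)) - real (card (bad_pairs (int k, int l) a))
    \<and> real (card (good_pairs (int k, int l) a))
        = (real m * (real k + 1) - real n * real l) / (real k + 1) * real ((k + l) choose l)"
proof -
  let ?A = "all_pairs (int k, int l) a"
  let ?B = "bad_pairs (int k, int l) a"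
  let ?G = "good_pairs (int k, int l) a"
  have m: "length a = m" and n: "sum_list a = n"
    using assms(1) by (auto simp: weak_composition_def)
  have A: "card ?A = m * ((k + l) choose l)"
    using finite_card_words[of k l] m unfolding all_pairs_eq
    by (simp add: card_image inj_on_subset[OF inj_pair_of_word] card_cartesian_product)
  have finite: "finite ?A"
    using finite_card_words[of k l] unfolding all_pairs_eq by simp
  have window: "part_sum_up a j l \<le> Suc k" if "0 \<le> j" "j < int (length a)" for j
  proof -
    have "a \<noteq> []" using that by auto
    then show ?thesis
      using assms(3) assms(4)[of j] dominates_point_cyclic_shift[of a l j "Suc k"] that m
      by (simp add: add.commute)
  qed
  have B: "card ?B = n * (if l = 0 then 0 else (k + l) choose (l - 1))"
    using card_bad_words[OF window] assms(3) m n
    by (simp add: bad_pairs_eq card_image inj_on_subset[OF inj_pair_of_word])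
  have "?A = ?G \<union> ?B" "?G \<inter> ?B = {}"
    by (auto simp: good_pairs_def bad_pairs_def)
  then have "card ?A = card ?G + card ?B"
    using finite by (metis card_Un_disjoint finite_Un)
  then have G: "real (card ?G) = real (card ?A) - real (card ?B)"
    by simp
  \<comment> \<open>For positive \<open>l\<close> both sides equal
    \<open>(k + l) * ((k + l - 1) choose (l - 1))\<close>.\<close>
  have "(k + 1) * (if l = 0 then 0 else (k + l) choose (l - 1)) = l * ((k + l) choose l)"
  proof (cases l)
    case (Suc l')
    then show ?thesis
      using binomial_absorb_comp[of "k + l" l'] binomial_absorption[of l' "k + l"]
      by (simp add: Suc_diff_le)
  qed simp
  then have "(real k + 1) * real (if l = 0 then 0 else (k + l) choose (l - 1))
      = real l * real ((k + l) choose l)"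
    by (metis of_nat_1 of_nat_add of_nat_mult)
  then have "real (card ?B) = real n * (real l * real ((k + l) choose l) / (real k + 1))"
    unfolding B by (simp add: field_simps)
  then have "real (card ?G)
      = (real m * (real k + 1) - real n * real l) / (real k + 1) * real ((k + l) choose l)"
    unfolding G A by (simp add: field_simps)
  then show ?thesis using A B G by blast
qed

end
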